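(* Let $G$ be a probability distribution on $[0,\infty)$ and let $K$ be a Markov transition kernel on $[0,\infty)$. Then $K\in D(G)$ if and only if there exist a measurable function $\psi^*:[0,\infty)\times[0,1]\to[0,\infty)$ and a random variable $\xi^*\sim G$ on the uniform probability space $([0,1],\mathcal B,\lambda)$ such that $$t^{-1}\psi^*(t,u)\longrightarrow\xi^*(u)\qquad\text{for all }u\in[0,1]$$ as $t\to\infty$, and $\psi^*$ is an update function corresponding to $K$ in the sense that $$\lambda\big[\psi^*(y,\cdot)\in A\big]=K(y,A)$$ for all $y\in[0,\infty)$ and all measurable sets $A\subset[0,\infty)$.
   Context: A Markov transition kernel $K:[0,\infty)\times\mathcal B[0,\infty)\to[0,1]$ is in the domain of attraction of $G$, written $K\in D(G)$, if $K(t,t\,\cdot)\Rightarrow G(\cdot)$ on $[0,\infty]$ as $t\to\infty$ (weak convergence; $tA=\{ta:a\in A\}$). $\lambda$ is Lebesgue measure on the Borel sets $\mathcal B$ of $[0,1]$. *)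

theory Defs
  imports "HOL-Probability.Probability"
begin

abbreviation halfline :: "real measure" where
  "halfline \<equiv> restrict_space borel {0..}"

abbreviation uniform01 :: "real measure" where
  "uniform01 \<equiv> restrict_space lborel {0..1}"

abbreviation markov_kernels :: "(real \<Rightarrow> real measure) set" where
  "markov_kernels \<equiv> halfline \<rightarrow>\<^sub>M prob_algebra halfline"

text \<open>The library's weak convergence concerns sequences of measures on the real line; here
  the index is a continuous parameter and the space is arbitrary.\<close>

definition weakly_converges ::
    "('i \<Rightarrow> 'a::topological_space measure) \<Rightarrow> 'a measure \<Rightarrow> 'i filter \<Rightarrow> bool" where
  "weakly_converges M N F \<longleftrightarrow>
     (\<forall>f::'a \<Rightarrow> real. continuous_on UNIV f \<longrightarrow> bounded (range f) \<longrightarrow>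
        ((\<lambda>i. \<integral>x. f x \<partial>M i) \<longlongrightarrow> (\<integral>x. f x \<partial>N)) F)"

text \<open>A measure on \<open>[0,\<infinity>)\<close> regarded as a measure on the compact space \<open>[0,\<infinity>]\<close>,
  which is the type \<^typ>\<open>ennreal\<close> with its order topology.\<close>

definition on_extended :: "real measure \<Rightarrow> ennreal measure" where
  "on_extended M = distr M borel ennreal"

text \<open>The measure \<open>A \<mapsto> K(t, tA)\<close>, meaningful for \<open>t > 0\<close>: it is the image of
  \<open>K(t, \<cdot>)\<close> under \<open>x \<mapsto> x / t\<close>.\<close>

definition rescaled :: "(real \<Rightarrow> real measure) \<Rightarrow> real \<Rightarrow> real measure" where
  "rescaled K t = distr (K t) halfline (\<lambda>x. x / t)"

definition domain_of_attraction :: "real measure \<Rightarrow> (real \<Rightarrow> real measure) set" where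
  "domain_of_attraction G =
     {K \<in> markov_kernels.
        weakly_converges (\<lambda>t. on_extended (rescaled K t)) (on_extended G) at_top}"

definition update_function :: "(real \<Rightarrow> real measure) \<Rightarrow> (real \<Rightarrow> real \<Rightarrow> real) \<Rightarrow> bool" where
  "update_function K \<psi> \<longleftrightarrow>
     (\<forall>y\<in>{0..}. \<forall>A\<in>sets halfline. \<P>(u in uniform01. \<psi> y u \<in> A) = measure (K y) A)"

end

theory Submission
  imports Defs
begin

text \<open>Realise every \<open>K(t, \<cdot>)\<close> on the uniform probability space by its quantile function.
  Quantile functions commute with scaling, and weak convergence on \<open>[0,\<infinity>]\<close> to a limit carried by
  \<open>[0,\<infinity>)\<close> forces the rescaled quantile functions to converge wherever the quantile function of
  \<open>G\<close> is continuous, hence off a countable set; on that null set everything is redefined to be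
  \<open>0\<close>. Conversely, pointwise convergence of the update functions yields weak convergence by
  dominated convergence.\<close>

section \<open>Quantile functions of laws on the half-line\<close>

text \<open>The law is first pushed to the real line, where \<open>cdf\<close> and the locale
  \<open>cdf_distribution\<close> apply: for a law on the half-line itself, \<open>{..x}\<close> is
  not a measurable set.\<close>

definition quantile :: "real measure \<Rightarrow> real \<Rightarrow> real" where
  "quantile M u = Inf {x. u \<le> cdf (distr M borel (\<lambda>x. x)) x}"

text \<open>\<open>D\<close> will be a countable exceptional set, the same for all laws involved.
  The value 0 also covers the endpoints, where the infimum is no genuine quantile: at 0 it runs over
  all reals, at 1 its set may be empty. Division by \<open>t\<close> preserves 0, so convergence is
  trivial at all these points.\<close>

definition quantile_off :: "real set \<Rightarrow> real measure \<Rightarrow> real \<Rightarrow> real" where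
  "quantile_off D M u = (if u \<in> {0<..<1} - D then quantile M u else 0)"

lemma sets_halfline_Icc: "0 \<le> a \<Longrightarrow> {a..b} \<in> sets halfline"
  by (auto simp: sets_restrict_space_iff)

text \<open>Bridges the product space, built over \<open>borel\<close>, and the probability space,
  built over \<open>lborel\<close>.\<close>

lemma sets_uniform01: "sets uniform01 = sets (restrict_space borel {0..1})"
  by (simp add: sets_restrict_space)

lemma prob_space_uniform01: "prob_space uniform01"
  by (auto simp: space_restrict_space emeasure_restrict_space intro!: prob_spaceI)

lemma emeasure_uniform01:
  assumes "A \<in> sets uniform01"
  shows "emeasure uniform01 A = emeasure lborel A"
  using assms by (subst emeasure_restrict_space) (auto simp: sets_restrict_space)

lemma prob_halflineD:
  assumes "M \<in> space (prob_algebra halfline)"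
  shows "prob_space M" "sets M = sets halfline" "space M = {0..}"
proof -
  show "prob_space M" and s: "sets M = sets halfline"
    using assms by (auto simp: space_prob_algebra)
  from sets_eq_imp_space_eq[OF s] show "space M = {0..}"
    by (simp add: space_restrict_space)
qed

lemma measurable_halfline_borel:
  assumes "sets M = sets halfline" "f \<in> borel_measurable borel"
  shows "f \<in> borel_measurable M"
  using assms by (auto intro: measurable_restrict_space1 simp: measurable_cong_sets[OF assms(1) refl])

lemma cdf_on_line:
  assumes "M \<in> space (prob_algebra halfline)"
  shows "cdf (distr M borel (\<lambda>x. x)) x = measure M {0..x}"
proof -
  note M = prob_halflineD[OF assms]
  have "{..x} \<inter> space M = {0..x}"
    using M by auto
  then show ?thesis
    unfolding cdf_def
    by (subst measure_distr) (auto intro: measurable_halfline_borel[OF M(2)])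
qed

lemma cdf_distribution_on_line:
  assumes "M \<in> space (prob_algebra halfline)"
  shows "cdf_distribution (distr M borel (\<lambda>x. x))"
proof -
  note M = prob_halflineD[OF assms]
  have "prob_space (distr M borel (\<lambda>x. x))"
    by (intro prob_space.prob_space_distr M(1) measurable_halfline_borel[OF M(2)]) auto
  then show ?thesis
    by (auto simp: cdf_distribution_def real_distribution_def real_distribution_axioms_def)
qed

text \<open>Right-continuity of the distribution function makes the infimum attained. This Galois
  connection turns questions about quantiles into questions about
  \<open>measure M {0..x}\<close>.\<close>

lemma quantile_le_iff:
  assumes "M \<in> space (prob_algebra halfline)" "0 < u" "u < 1"
  shows "quantile M u \<le> x \<longleftrightarrow> u \<le> measure M {0..x}"
proof -
  interpret cdf_distribution "distr M borel (\<lambda>x. x)"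
    by (rule cdf_distribution_on_line[OF assms(1)])
  show ?thesis
    unfolding quantile_def cdf_on_line[OF assms(1), symmetric]
    by (rule pseudoinverse[OF assms(2,3), symmetric])
qed

text \<open>For negative \<open>x\<close> the interval \<open>{0..x}\<close> is empty, and its
  measure 0 cannot reach \<open>u\<close>.\<close>

lemma quantile_nonneg:
  assumes "M \<in> space (prob_algebra halfline)" "0 < u" "u < 1"
  shows "0 \<le> quantile M u"
proof (rule ccontr)
  assume "\<not> 0 \<le> quantile M u"
  then show False
    using quantile_le_iff[OF assms, of "quantile M u"] assms by simp
qed

lemma mono_on_quantile:
  assumes "M \<in> space (prob_algebra halfline)"
  shows "mono_on {0<..<1} (quantile M)"
proof -
  interpret cdf_distribution "distr M borel (\<lambda>x. x)"
    by (rule cdf_distribution_on_line[OF assms])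
  show ?thesis
    using mono_I by (simp add: quantile_def[abs_def])
qed

section \<open>Measurability and law of the modified quantile functions\<close>

lemma quantile_off_nonneg:
  assumes "M \<in> space (prob_algebra halfline)"
  shows "0 \<le> quantile_off D M u"
  using quantile_nonneg[OF assms] by (auto simp: quantile_off_def)

text \<open>By the Galois connection, a sublevel set of the quantile compares \<open>u\<close> with
  \<open>measure (K t) {0..x}\<close>, which is measurable in \<open>t\<close> because
  \<open>K\<close> is a kernel. Joint measurability follows.\<close>

lemma measurable_quantile_off:
  assumes K: "K \<in> N \<rightarrow>\<^sub>M prob_algebra halfline" and D: "countable D"
  shows "(\<lambda>(t, u). quantile_off D (K t) u) \<in> N \<Otimes>\<^sub>M restrict_space borel {0..1} \<rightarrow>\<^sub>M halfline"
proof (rule measurable_restrict_space2)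
  let ?P = "N \<Otimes>\<^sub>M restrict_space borel {0..1::real}"
  have Kt: "K (fst w) \<in> space (prob_algebra halfline)" if "w \<in> space ?P" for w
    using measurable_space[OF K] that by (auto simp: space_pair_measure)
  then show "(\<lambda>(t, u). quantile_off D (K t) u) \<in> space ?P \<rightarrow> {0..}"
    by (auto intro!: quantile_off_nonneg)
  have D_borel[measurable]: "D \<in> sets borel"
    by (rule sets.countable[OF _ D]) auto
  have snd[measurable]: "snd \<in> borel_measurable ?P"
    using measurable_snd[of N "restrict_space borel {0..1::real}"]
    by (rule measurable_restrict_space2_iff[THEN iffD1, THEN conjunct1])
  show "(\<lambda>(t, u). quantile_off D (K t) u) \<in> borel_measurable ?P"
    unfolding borel_measurable_iff_le
  proof
    fix x :: real
    have m: "(\<lambda>w. measure (K (fst w)) {0..x}) \<in> borel_measurable ?P"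
      using measurable_compose[OF measurable_compose[OF measurable_fst K]
        measurable_measure_prob_algebra[OF sets_halfline_Icc[OF order_refl, of x]]] .
    have "{w \<in> space ?P. (case w of (t, u) \<Rightarrow> quantile_off D (K t) u) \<le> x} =
      {w \<in> space ?P. if snd w \<in> {0<..<1} - D then snd w \<le> measure (K (fst w)) {0..x} else 0 \<le> x}"
      by (intro Collect_cong conj_cong refl)
         (use Kt in \<open>auto simp: quantile_off_def quantile_le_iff split: if_splits\<close>)
    also have "\<dots> \<in> sets ?P"
      using m by measurable
    finally show "{w \<in> space ?P. (case w of (t, u) \<Rightarrow> quantile_off D (K t) u) \<le> x} \<in> sets ?P" .
  qed
qed

text \<open>A single law is a constant kernel over a one-point space, so this is a section of the
  joint statement.\<close>

lemma measurable_quantile_off1: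
  assumes M: "M \<in> space (prob_algebra halfline)" and D: "countable D"
  shows "quantile_off D M \<in> uniform01 \<rightarrow>\<^sub>M halfline"
proof -
  have "(\<lambda>_. M) \<in> count_space {()} \<rightarrow>\<^sub>M prob_algebra halfline"
    using M by simp
  from measurable_Pair2[OF measurable_quantile_off[OF this D], of "()"]
  have "quantile_off D M \<in> restrict_space borel {0..1} \<rightarrow>\<^sub>M halfline"
    by simp
  then show ?thesis
    by (simp add: measurable_cong_sets[OF sets_uniform01 refl])
qed

text \<open>Inverse transform sampling on the open unit interval; the redefinition on
  \<open>D\<close> and the two added endpoints change only a Lebesgue null set.\<close>

lemma distr_quantile_off:
  assumes M: "M \<in> space (prob_algebra halfline)" and D: "countable D"
  shows "distr uniform01 halfline (quantile_off D M) = M"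
proof (rule measure_eqI)
  note Mh = prob_halflineD[OF M]
  note meas = measurable_quantile_off1[OF M D]
  interpret cdf_distribution "distr M borel (\<lambda>x. x)"
    by (rule cdf_distribution_on_line[OF M])
  let ?U = "restrict_space lborel {0<..<1::real}"
  have I: "I = quantile M"
    by (simp add: quantile_def[abs_def])
  have q: "quantile M \<in> borel_measurable ?U"
    using measurable_CI unfolding I by (simp add: measurable_cong_sets[OF _ refl] sets_restrict_space)
  have null: "countable (D \<union> {0, 1})"
    using D by simp
  show "sets (distr uniform01 halfline (quantile_off D M)) = sets M"
    using Mh by simp
  fix A assume "A \<in> sets (distr uniform01 halfline (quantile_off D M))"
  then have A: "A \<in> sets halfline"
    by simp
  then have Ab: "A \<in> sets borel" and A0: "A \<subseteq> {0..}"
    by (auto simp: sets_restrict_space_iff)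
  have E: "quantile_off D M -` A \<inter> {0..1} \<in> sets uniform01"
    using measurable_sets[OF meas A] by (simp add: space_restrict_space)
  have F: "quantile M -` A \<inter> {0<..<1} \<in> sets ?U"
    using measurable_sets[OF q Ab] by (simp add: space_restrict_space)
  have "emeasure (distr uniform01 halfline (quantile_off D M)) A =
      emeasure uniform01 (quantile_off D M -` A \<inter> {0..1})"
    using meas A by (simp add: emeasure_distr space_restrict_space)
  also have "\<dots> = emeasure lborel (quantile_off D M -` A \<inter> {0..1})"
    by (rule emeasure_uniform01[OF E])
  also have "\<dots> = emeasure lborel (quantile M -` A \<inter> {0<..<1})"
  proof (rule emeasure_eq_AE)
    have "AE u in lborel. u \<notin> D \<union> {0, 1}"
      using emeasure_lborel_countable[OF null]
      by (intro AE_not_in null_setsI sets.countable[OF _ null]) auto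
    then show "AE u in lborel. (u \<in> quantile_off D M -` A \<inter> {0..1}) =
        (u \<in> quantile M -` A \<inter> {0<..<1})"
      by eventually_elim (auto simp: quantile_off_def)
  qed (use E F in \<open>auto simp: sets_restrict_space_iff\<close>)
  also have "\<dots> = emeasure (distr ?U borel (quantile M)) A"
    using q Ab F
    by (auto simp: emeasure_distr space_restrict_space emeasure_restrict_space)
  also have "\<dots> = emeasure (distr M borel (\<lambda>x. x)) A"
    using distr_I_eq_M unfolding I by simp
  also have "\<dots> = emeasure M A"
    using Ab A0 Mh by (subst emeasure_distr)
      (auto intro: measurable_halfline_borel[OF Mh(2)] intro!: arg_cong[where f="emeasure M"])
  finally show "emeasure (distr uniform01 halfline (quantile_off D M)) A = emeasure M A" .
qed

section \<open>Ramp functions as continuous tests on the extended half-line\<close>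

text \<open>The cut-off at \<open>b\<close> makes the ramp continuous at \<open>\<infinity>\<close>, where \<^const>\<open>enn2real\<close> is not.\<close>

definition ramp :: "real \<Rightarrow> real \<Rightarrow> ennreal \<Rightarrow> real" where
  "ramp a b y = min 1 ((b - enn2real (min y (ennreal b))) / (b - a))"

lemma continuous_ramp:
  assumes "a < b"
  shows "continuous_on UNIV (ramp a b)"
proof -
  have "continuous_on UNIV (\<lambda>y. enn2real (min y (ennreal b)))"
    unfolding continuous_on_def
  proof
    fix y :: ennreal
    \<comment> \<open>The limit is written as \<open>ennreal\<close> of a real, which is legitimate
      since it is at most \<open>ennreal b\<close> and hence finite; \<open>tendsto_enn2real\<close>
      needs this form.\<close>
    have "((\<lambda>z. min z (ennreal b)) \<longlongrightarrow> ennreal (enn2real (min y (ennreal b)))) (at y)"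
    proof -
      have "min y (ennreal b) < \<top>"
        by (simp add: min_less_iff_disj)
      then show ?thesis
        by (auto intro!: tendsto_eq_intros)
    qed
    then show "((\<lambda>z. enn2real (min z (ennreal b))) \<longlongrightarrow> enn2real (min y (ennreal b))) (at y)"
      by (rule tendsto_enn2real) simp
  qed
  then show ?thesis
    unfolding ramp_def[abs_def] using assms by (intro continuous_intros) auto
qed

lemma ramp_ennreal:
  assumes "0 \<le> x" "0 \<le> b"
  shows "ramp a b (ennreal x) = min 1 ((b - min x b) / (b - a))"
  using assms unfolding ramp_def by (simp add: min_def)

lemma ramp_bounds:
  assumes "a < b" "0 \<le> b"
  shows "0 \<le> ramp a b y" "ramp a b y \<le> 1"
proof -
  have "enn2real (min y (ennreal b)) \<le> enn2real (ennreal b)"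
    by (rule enn2real_mono) auto
  then show "0 \<le> ramp a b y" "ramp a b y \<le> 1"
    using assms by (auto simp: ramp_def)
qed

lemma integral_on_extended:
  assumes "M \<in> space (prob_algebra halfline)" "f \<in> borel_measurable borel"
  shows "(\<integral>x. f x \<partial>on_extended M) = (\<integral>x. (f (ennreal x) :: real) \<partial>M)"
  unfolding on_extended_def
  by (rule integral_distr[OF measurable_halfline_borel[OF prob_halflineD(2)[OF assms(1)]] assms(2)]) simp

text \<open>On the half-line the ramp lies between the indicators of \<open>{0..a}\<close> and
  \<open>{0..b}\<close>. This sandwich extracts information on distribution functions from weak
  convergence.\<close>

lemma integral_ramp_bounds:
  assumes M: "M \<in> space (prob_algebra halfline)" and ab: "0 \<le> a" "a < b"
  shows "measure M {0..a} \<le> (\<integral>x. ramp a b x \<partial>on_extended M)"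
    and "(\<integral>x. ramp a b x \<partial>on_extended M) \<le> measure M {0..b}"
proof -
  note Mh = prob_halflineD[OF M]
  interpret prob_space M by fact
  have rm: "ramp a b \<in> borel_measurable borel"
    by (intro borel_measurable_continuous_onI continuous_ramp ab)
  have eq: "(\<integral>x. ramp a b x \<partial>on_extended M) = (\<integral>x. ramp a b (ennreal x) \<partial>M)"
    by (rule integral_on_extended[OF M rm])
  have "(\<lambda>x. ramp a b (ennreal x)) \<in> borel_measurable borel"
    using rm by measurable
  then have int: "integrable M (\<lambda>x. ramp a b (ennreal x))"
    using ramp_bounds[of a b] ab
    by (intro integrable_const_bound[of _ 1] measurable_halfline_borel[OF Mh(2)]) auto
  have ind: "integrable M (indicat_real {0..c})" "measure M {0..c} = (\<integral>x. indicat_real {0..c} x \<partial>M)"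
    for c
    using Mh sets_halfline_Icc[of 0 c] sets.sets_into_space[of "{0..c}" M]
    by (auto simp: Int_absorb1 emeasure_eq_measure Int_absorb2)
  show "measure M {0..a} \<le> (\<integral>x. ramp a b x \<partial>on_extended M)"
    unfolding eq ind(2)
    by (intro integral_mono ind int)
       (use ab Mh in \<open>auto simp: indicator_def ramp_ennreal min_def divide_simps\<close>)
  show "(\<integral>x. ramp a b x \<partial>on_extended M) \<le> measure M {0..b}"
    unfolding eq ind(2)
    by (intro integral_mono ind int)
       (use ab Mh in \<open>auto simp: indicator_def ramp_ennreal min_def divide_simps\<close>)
qed

section \<open>Weak convergence implies convergence of quantiles\<close>

text \<open>Strict bounds on ramp integrals under \<open>G\<close> pass to \<open>M i\<close>
  eventually; the sandwich and the Galois connection turn them into bounds on the quantiles of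
  \<open>M i\<close>.\<close>

lemma quantile_tendsto:
  assumes M: "\<forall>\<^sub>F i in F. M i \<in> space (prob_algebra halfline)"
    and G: "G \<in> space (prob_algebra halfline)"
    and conv: "weakly_converges (\<lambda>i. on_extended (M i)) (on_extended G) F"
    and u: "0 < u" "u < 1" and cont: "isCont (quantile G) u"
  shows "((\<lambda>i. quantile (M i) u) \<longlongrightarrow> quantile G u) F"
proof -
  have ramp_conv: "((\<lambda>i. \<integral>x. ramp a b x \<partial>on_extended (M i)) \<longlongrightarrow> (\<integral>x. ramp a b x \<partial>on_extended G)) F"
    if "0 \<le> a" "a < b" for a b
  proof -
    have "bounded (range (ramp a b))"
    proof (rule boundedI[of _ 1])
      fix r assume "r \<in> range (ramp a b)"
      then obtain y where "r = ramp a b y"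
        by blast
      moreover have "0 \<le> ramp a b y" "ramp a b y \<le> 1"
        using ramp_bounds[of a b y] that by auto
      ultimately show "norm r \<le> 1"
        by simp
    qed
    then show ?thesis
      using conv continuous_ramp[OF that(2)] unfolding weakly_converges_def by blast
  qed
  show ?thesis
  proof (rule order_tendstoI)
    fix a assume a: "a < quantile G u"
    show "\<forall>\<^sub>F i in F. a < quantile (M i) u"
    proof (cases "0 \<le> a")
      case False
      show ?thesis
        using M by eventually_elim (use False quantile_nonneg[OF _ u] in force)
    next
      case True
      obtain b where b: "a < b" "b < quantile G u"
        using dense[OF a] by blast
      \<comment> \<open>Since \<open>b\<close> lies below the quantile,
        \<open>measure G {0..b}\<close> is strictly below \<open>u\<close>, which dominates the ramp
        integral.\<close>
      have "(\<integral>x. ramp a b x \<partial>on_extended G) < u"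
        using integral_ramp_bounds(2)[OF G True b(1)] quantile_le_iff[OF G u, of b] b(2) by linarith
      from order_tendstoD(2)[OF ramp_conv[OF True b(1)] this] M show ?thesis
      proof eventually_elim
        case (elim i)
        then show ?case
          using integral_ramp_bounds(1)[OF elim(2) True b(1)] quantile_le_iff[OF elim(2) u, of a]
          by linarith
      qed
    qed
  next
    fix c assume c: "quantile G u < c"
    obtain b where b: "quantile G u < b" "b < c"
      using dense[OF c] by blast
    \<comment> \<open>At \<open>u\<close> itself the Galois connection yields only a weak
      inequality. Continuity supplies a level \<open>v > u\<close> whose quantile is still below
      \<open>b\<close>; the gap between \<open>u\<close> and \<open>v\<close> makes the ramp
      integral strictly larger than \<open>u\<close>.\<close>
    have "(quantile G \<longlongrightarrow> quantile G u) (at_right u)"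
      using cont by (auto simp: isCont_def intro: tendsto_within_subset)
    from order_tendstoD(2)[OF this b(1)] eventually_at_right_real[OF u(2)]
    have "\<forall>\<^sub>F v in at_right u. quantile G v < b \<and> u < v \<and> v < 1"
      by eventually_elim simp
    then obtain v where v: "quantile G v < b" "u < v" "v < 1"
      using eventually_happens'[OF trivial_limit_at_right_real] by blast
    have v0: "0 < v"
      using u v by simp
    let ?a = "quantile G v"
    have a: "0 \<le> ?a"
      by (rule quantile_nonneg[OF G v0 v(3)])
    have "v \<le> measure G {0..?a}"
      using quantile_le_iff[OF G v0 v(3)] by blast
    then have "u < (\<integral>x. ramp ?a b x \<partial>on_extended G)"
      using integral_ramp_bounds(1)[OF G a v(1)] v by linarith
    from order_tendstoD(1)[OF ramp_conv[OF a v(1)] this] M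
    show "\<forall>\<^sub>F i in F. quantile (M i) u < c"
    proof eventually_elim
      case (elim i)
      then have "quantile (M i) u \<le> b"
        using integral_ramp_bounds(2)[OF elim(2) a v(1)] quantile_le_iff[OF elim(2) u, of b] by linarith
      then show ?case
        using b by simp
    qed
  qed
qed

section \<open>Scaling of laws and quantiles\<close>

lemma measurable_scale_halfline:
  assumes "0 < t" "sets M = sets halfline"
  shows "(\<lambda>x. x / t) \<in> M \<rightarrow>\<^sub>M halfline"
  using assms sets_eq_imp_space_eq[OF assms(2)]
  by (intro measurable_restrict_space2 measurable_halfline_borel[OF assms(2)])
     (auto simp: space_restrict_space)

lemma rescaled_in_prob_algebra:
  assumes "K t \<in> space (prob_algebra halfline)" "0 < t"
  shows "rescaled K t \<in> space (prob_algebra halfline)"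
  using prob_halflineD[OF assms(1)] assms(2)
  by (auto simp: space_prob_algebra rescaled_def
      intro!: prob_space.prob_space_distr measurable_scale_halfline)

text \<open>Both sides have the same upper bounds \<open>x\<close>, since \<open>{0..x}\<close>
  pulls back to \<open>{0..x * t}\<close>; taking each side as \<open>x\<close> gives
  equality.\<close>

lemma quantile_rescaled:
  assumes K: "K t \<in> space (prob_algebra halfline)" and t: "0 < t" and u: "0 < u" "u < 1"
  shows "quantile (rescaled K t) u = quantile (K t) u / t"
proof -
  note Kh = prob_halflineD[OF K]
  have "quantile (rescaled K t) u \<le> x \<longleftrightarrow> quantile (K t) u / t \<le> x" for x
  proof -
    have "(\<lambda>y. y / t) -` {0..x} \<inter> space (K t) = {0..x * t}"
      using Kh t by (auto simp: field_simps)
    then have "measure (rescaled K t) {0..x} = measure (K t) {0..x * t}"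
      unfolding rescaled_def
      by (subst measure_distr[OF measurable_scale_halfline[OF t Kh(2)] sets_halfline_Icc]) auto
    then show ?thesis
      using t by (simp add: quantile_le_iff rescaled_in_prob_algebra K u pos_divide_le_eq)
  qed
  from this[of "quantile (rescaled K t) u"] this[of "quantile (K t) u / t"] show ?thesis
    by simp
qed

section \<open>From pointwise convergence to weak convergence\<close>

text \<open>Serves to replace the rescaled kernel by an image of the uniform law, an identity
  established only for \<open>t > 0\<close>.\<close>

lemma weakly_converges_cong:
  fixes N :: "'a::topological_space measure"
  assumes "weakly_converges M N F" "\<forall>\<^sub>F i in F. M i = M' i"
  shows "weakly_converges M' N F"
  unfolding weakly_converges_def
proof (intro allI impI)
  fix f :: "'a \<Rightarrow> real" assume "continuous_on UNIV f" "bounded (range f)"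
  with assms(1) have "((\<lambda>i. \<integral>x. f x \<partial>M i) \<longlongrightarrow> (\<integral>x. f x \<partial>N)) F"
    by (simp add: weakly_converges_def)
  then show "((\<lambda>i. \<integral>x. f x \<partial>M' i) \<longlongrightarrow> (\<integral>x. f x \<partial>N)) F"
    by (rule Lim_transform_eventually) (use assms(2) in eventually_elim, simp)
qed

text \<open>A bounded continuous test function turns the pointwise limit into a limit of integrals,
  by dominated convergence with a constant bound on a probability space.\<close>

lemma weakly_converges_distr_at_top:
  fixes g :: "'b \<Rightarrow> 'a::topological_space"
  assumes U: "prob_space U"
    and X: "\<forall>\<^sub>F t in at_top. X t \<in> U \<rightarrow>\<^sub>M N" and Y: "Y \<in> U \<rightarrow>\<^sub>M N"
    and g: "g \<in> N \<rightarrow>\<^sub>M borel"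
    and conv: "\<And>u. u \<in> space U \<Longrightarrow> ((\<lambda>t::real. g (X t u)) \<longlongrightarrow> g (Y u)) at_top"
  shows "weakly_converges (\<lambda>t. distr (distr U N (X t)) borel g) (distr (distr U N Y) borel g) at_top"
  unfolding weakly_converges_def
proof (intro allI impI)
  fix f :: "'a \<Rightarrow> real" assume f: "continuous_on UNIV f" "bounded (range f)"
  then have fm: "f \<in> borel_measurable borel"
    by (intro borel_measurable_continuous_onI)
  obtain B where B: "\<And>x. \<bar>f x\<bar> \<le> B"
    using f(2) by (auto simp: bounded_iff)
  interpret prob_space U by fact
  have integral_eq: "(\<integral>x. f x \<partial>distr (distr U N Z) borel g) = (\<integral>u. f (g (Z u)) \<partial>U)"
    if "Z \<in> U \<rightarrow>\<^sub>M N" for Z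
    using that g fm by (simp add: integral_distr)
  have fgm: "(\<lambda>x. f (g x)) \<in> borel_measurable N"
    using g fm by measurable
  obtain T where T: "\<And>t. T \<le> t \<Longrightarrow> X t \<in> U \<rightarrow>\<^sub>M N"
    using X by (auto simp: eventually_at_top_linorder)
  \<comment> \<open>Dominated convergence asks for measurability at every index;
    \<open>max T t\<close> ensures it and equals \<open>t\<close> eventually.\<close>
  let ?X = "\<lambda>t. X (max T t)"
  have ev: "\<forall>\<^sub>F t in at_top. max T t = t"
    using eventually_ge_at_top[of T] by eventually_elim simp
  have "((\<lambda>t. \<integral>u. f (g (?X t u)) \<partial>U) \<longlongrightarrow> (\<integral>u. f (g (Y u)) \<partial>U)) at_top"
  proof (rule integral_dominated_convergence_at_top)
    show "(\<lambda>u. f (g (Y u))) \<in> borel_measurable U"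
      by (rule measurable_compose[OF Y fgm])
    show "(\<lambda>u. f (g (?X t u))) \<in> borel_measurable U" for t
      by (rule measurable_compose[OF T fgm]) simp
    show "integrable U (\<lambda>_. B)"
      by simp
    show "\<forall>\<^sub>F t in at_top. AE u in U. norm (f (g (?X t u))) \<le> B"
      using B by simp
    show "AE u in U. ((\<lambda>t. f (g (?X t u))) \<longlongrightarrow> f (g (Y u))) at_top"
    proof (rule AE_I2)
      fix u assume "u \<in> space U"
      from continuous_on_tendsto_compose[OF f(1) conv[OF this]]
      have "((\<lambda>t. f (g (X t u))) \<longlongrightarrow> f (g (Y u))) at_top"
        by simp
      then show "((\<lambda>t. f (g (?X t u))) \<longlongrightarrow> f (g (Y u))) at_top"
        by (rule Lim_transform_eventually) (use ev in eventually_elim, simp)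
    qed
  qed
  then show "((\<lambda>t. \<integral>x. f x \<partial>distr (distr U N (X t)) borel g) \<longlongrightarrow>
      (\<integral>x. f x \<partial>distr (distr U N Y) borel g)) at_top"
    unfolding integral_eq[OF Y]
    by (rule Lim_transform_eventually)
       (use ev X in eventually_elim, simp add: integral_eq)
qed

section \<open>The two implications\<close>

theorem proposition2p4:
  fixes G :: "real measure" and K :: "real \<Rightarrow> real measure"
  assumes "G \<in> space (prob_algebra halfline)"
    and "K \<in> markov_kernels"
  shows "K \<in> domain_of_attraction G \<longleftrightarrow>
    (\<exists>(\<psi> :: real \<Rightarrow> real \<Rightarrow> real) (\<xi> :: real \<Rightarrow> real).
       (\<lambda>(t, u). \<psi> t u) \<in> halfline \<Otimes>\<^sub>M restrict_space borel {0..1} \<rightarrow>\<^sub>M halfline \<and>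
       \<xi> \<in> uniform01 \<rightarrow>\<^sub>M halfline \<and>
       distr uniform01 halfline \<xi> = G \<and>
       (\<forall>u\<in>{0..1}. ((\<lambda>t. \<psi> t u / t) \<longlongrightarrow> \<xi> u) at_top) \<and>
       update_function K \<psi>)"
proof -
  have Kt: "K t \<in> space (prob_algebra halfline)" if "0 \<le> t" for t
    using measurable_space[OF assms(2)] that by (simp add: space_restrict_space)
  have measure_eq: "\<P>(u in uniform01. f u \<in> A) = measure (distr uniform01 halfline f) A"
    if "f \<in> uniform01 \<rightarrow>\<^sub>M halfline" "A \<in> sets halfline" for f A
    using measure_distr[OF that] by (simp add: vimage_def Int_def conj_commute)
  show ?thesis
  proof
    assume "K \<in> domain_of_attraction G"
    then have conv: "weakly_converges (\<lambda>t. on_extended (rescaled K t)) (on_extended G) at_top"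
      by (simp add: domain_of_attraction_def)
    \<comment> \<open>A monotone function has only countably many discontinuities, so redefining all
      quantile functions on \<open>D\<close> leaves their laws unchanged.\<close>
    define D where "D = {u \<in> {0<..<1}. \<not> isCont (quantile G) u}"
    have D: "countable D"
      unfolding D_def by (intro mono_on_ctble_discont_open mono_on_quantile assms) auto
    have resc: "\<forall>\<^sub>F t in at_top. rescaled K t \<in> space (prob_algebra halfline)"
      using eventually_gt_at_top[of 0]
      by eventually_elim (auto intro!: rescaled_in_prob_algebra Kt)
    have lim: "((\<lambda>t. quantile_off D (K t) u / t) \<longlongrightarrow> quantile_off D G u) at_top" for u
    proof (cases "u \<in> {0<..<1} - D")
      case True
      then have u: "0 < u" "u < 1" and cont: "isCont (quantile G) u"
        by (auto simp: D_def)
      have "((\<lambda>t. quantile (K t) u / t) \<longlongrightarrow> quantile G u) at_top"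
        using quantile_tendsto[OF resc assms(1) conv u cont]
      proof (rule Lim_transform_eventually)
        show "\<forall>\<^sub>F t in at_top. quantile (rescaled K t) u = quantile (K t) u / t"
          using eventually_gt_at_top[of 0]
          by eventually_elim (auto intro!: quantile_rescaled Kt u)
      qed
      with True show ?thesis
        by (simp add: quantile_off_def)
    qed (auto simp: quantile_off_def)
    have upd: "update_function K (\<lambda>t. quantile_off D (K t))"
      unfolding update_function_def
      using measure_eq measurable_quantile_off1[OF Kt D] distr_quantile_off[OF Kt D] by simp
    show "\<exists>\<psi> \<xi>.
       (\<lambda>(t, u). \<psi> t u) \<in> halfline \<Otimes>\<^sub>M restrict_space borel {0..1} \<rightarrow>\<^sub>M halfline \<and>
       \<xi> \<in> uniform01 \<rightarrow>\<^sub>M halfline \<and>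
       distr uniform01 halfline \<xi> = G \<and>
       (\<forall>u\<in>{0..1}. ((\<lambda>t. \<psi> t u / t) \<longlongrightarrow> \<xi> u) at_top) \<and>
       update_function K \<psi>"
      using measurable_quantile_off[OF assms(2) D] measurable_quantile_off1[OF assms(1) D]
        distr_quantile_off[OF assms(1) D] lim upd
      by (intro exI[of _ "\<lambda>t. quantile_off D (K t)"] exI[of _ "quantile_off D G"]) simp
  next
    assume "\<exists>\<psi> \<xi>.
       (\<lambda>(t, u). \<psi> t u) \<in> halfline \<Otimes>\<^sub>M restrict_space borel {0..1} \<rightarrow>\<^sub>M halfline \<and>
       \<xi> \<in> uniform01 \<rightarrow>\<^sub>M halfline \<and>
       distr uniform01 halfline \<xi> = G \<and>
       (\<forall>u\<in>{0..1}. ((\<lambda>t. \<psi> t u / t) \<longlongrightarrow> \<xi> u) at_top) \<and>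
       update_function K \<psi>"
    then obtain \<psi> \<xi> where
      psi: "(\<lambda>(t, u). \<psi> t u) \<in> halfline \<Otimes>\<^sub>M restrict_space borel {0..1} \<rightarrow>\<^sub>M halfline"
      and xi: "\<xi> \<in> uniform01 \<rightarrow>\<^sub>M halfline" "distr uniform01 halfline \<xi> = G"
      and lim: "\<And>u. u \<in> {0..1} \<Longrightarrow> ((\<lambda>t. \<psi> t u / t) \<longlongrightarrow> \<xi> u) at_top"
      and upd: "update_function K \<psi>"
      by blast
    have psi_t: "\<psi> t \<in> uniform01 \<rightarrow>\<^sub>M halfline" if "0 \<le> t" for t
      using measurable_Pair2[OF psi, of t] that
      by (simp add: measurable_cong_sets[OF sets_uniform01 refl] space_restrict_space)
    \<comment> \<open>\<open>update_function\<close> speaks of real-valued probabilities; as both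
      measures are finite, agreement there gives equality of measures.\<close>
    have K_eq: "K t = distr uniform01 halfline (\<psi> t)" if t: "0 \<le> t" for t
    proof (rule measure_eqI)
      note Kh = prob_halflineD[OF Kt[OF t]]
      interpret K: prob_space "K t" by fact
      interpret P: prob_space "distr uniform01 halfline (\<psi> t)"
        by (intro prob_space.prob_space_distr prob_space_uniform01 psi_t t)
      show "sets (K t) = sets (distr uniform01 halfline (\<psi> t))"
        using Kh by simp
      fix A assume "A \<in> sets (K t)"
      then show "emeasure (K t) A = emeasure (distr uniform01 halfline (\<psi> t)) A"
        using upd t measure_eq[OF psi_t[OF t], of A] Kh
        by (simp add: update_function_def K.emeasure_eq_measure P.emeasure_eq_measure)
    qed
    have scale: "(\<lambda>u. \<psi> t u / t) \<in> uniform01 \<rightarrow>\<^sub>M halfline" if "0 < t" for t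
      using measurable_compose[OF psi_t measurable_scale_halfline[OF that refl]] that by simp
    have resc: "rescaled K t = distr uniform01 halfline (\<lambda>u. \<psi> t u / t)" if t: "0 < t" for t
      using t unfolding rescaled_def K_eq[OF less_imp_le[OF t]]
      by (subst distr_distr) (auto intro: measurable_scale_halfline psi_t simp: comp_def)
    have "weakly_converges
        (\<lambda>t. distr (distr uniform01 halfline (\<lambda>u. \<psi> t u / t)) borel ennreal)
        (distr (distr uniform01 halfline \<xi>) borel ennreal) at_top"
    proof (rule weakly_converges_distr_at_top)
      show "\<forall>\<^sub>F t in at_top. (\<lambda>u. \<psi> t u / t) \<in> uniform01 \<rightarrow>\<^sub>M halfline"
        using eventually_gt_at_top[of 0] by eventually_elim (rule scale)
      show "ennreal \<in> halfline \<rightarrow>\<^sub>M borel"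
        by (rule measurable_halfline_borel) auto
      \<comment> \<open>The embedding into the extended half-line is continuous, so the assumed
        pointwise limits survive it.\<close>
      show "((\<lambda>t. ennreal (\<psi> t u / t)) \<longlongrightarrow> ennreal (\<xi> u)) at_top" if "u \<in> space uniform01" for u
        using lim[of u] that by (intro tendsto_ennrealI) (auto simp: space_restrict_space)
    qed (auto intro: prob_space_uniform01 xi)
    moreover have "\<forall>\<^sub>F t in at_top. distr (distr uniform01 halfline (\<lambda>u. \<psi> t u / t)) borel ennreal
        = on_extended (rescaled K t)"
      using eventually_gt_at_top[of 0] by eventually_elim (simp add: resc on_extended_def)
    ultimately have "weakly_converges (\<lambda>t. on_extended (rescaled K t)) (on_extended G) at_top"
      unfolding xi(2) on_extended_def[of G, symmetric] by (rule weakly_converges_cong)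
    then show "K \<in> domain_of_attraction G"
      using assms(2) by (simp add: domain_of_attraction_def)
  qed
qed

end
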